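(* For $\mathfrak{g}=\mathfrak{sl}(2,\mathbb{C})$ and its irreducible representation $V(m)$, $m\in\mathbb{N}$, the Fourier series of the character of the $N$-th symmetric power $S^N V(m)$, $N\in\mathbb{N}$, is given by $$\operatorname{Char}S^N V(m)(ix)=\sum_{i=0}^m q^{N(m-2i)}A_{m-2i,1}(q),$$ where $q=e^{ix}$ and the $A_{m-2i,1}(q)\in\mathbb{C}(q)$ are the rational functions $$A_{m-2i,1}(q)=(-1)^i q^{(m-i)(m-i+1)}\prod_{\substack{j=0\\ j\neq i}}^m\frac{1}{q^{2|i-j|}-1}.$$
   Context: $\mathbb{N}=\{0,1,2,\ldots\}$. $V(m)$ is the irreducible representation of $\mathfrak{sl}(2,\mathbb{C})$ of highest weight $m\omega_1$ (dimension $m+1$), where $\omega_1$ is the fundamental weight. For a representation $V$ with weight multiplicities $m_c$ (the dimension of the weight space of weight $c\,\omega_1$, $c\in\mathbb{Z}$), the Fourier series of its character is $\operatorname{Char}V(ix)=\sum_{c\in\mathbb{Z}}m_c\,q^c$ with $q=e^{ix}$ (the symbol $i$ in $e^{ix}$ and in $\operatorname{Char}(\cdot)(ix)$ is the imaginary unit, while elsewhere $i$ is a summation index). It is regarded as a Laurent polynomial in $q$, and the formula is an identity in $\mathbb{C}(q)$. *)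

theory Defs
  imports "HOL-Analysis.Analysis" "HOL-Library.Poly_Mapping" "HOL-Library.Multiset"
    "HOL-Combinatorics.Permutations" "HOL-Computational_Algebra.Fraction_Field"
    "HOL-Computational_Algebra.Polynomial"
begin

section \<open>Complex vector spaces\<close>

text \<open>
  The symmetric algebra below is a quotient type, so its construction needs the vector space
  structure to be attached to the type; the locale \<^locale>\<open>vector_space\<close> then supplies
  subspaces, spans and dimensions.
\<close>

class complex_vector = ab_group_add +
  fixes scaleC :: "complex \<Rightarrow> 'a \<Rightarrow> 'a"  (infixr "*\<^sub>C" 75)
  assumes scaleC_add_right: "a *\<^sub>C (x + y) = a *\<^sub>C x + a *\<^sub>C y"
    and scaleC_add_left: "(a + b) *\<^sub>C x = a *\<^sub>C x + b *\<^sub>C x"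
    and scaleC_scaleC: "a *\<^sub>C (b *\<^sub>C x) = (a * b) *\<^sub>C x"
    and scaleC_one: "1 *\<^sub>C x = x"

global_interpretation cvec: vector_space "scaleC :: complex \<Rightarrow> 'a \<Rightarrow> 'a::complex_vector"
  by unfold_locales (simp_all add: scaleC_add_right scaleC_add_left scaleC_scaleC scaleC_one)

abbreviation clinear :: "('a::complex_vector \<Rightarrow> 'b::complex_vector) \<Rightarrow> bool" where
  "clinear \<equiv> Vector_Spaces.linear scaleC scaleC"

lemma clinearI:
  assumes "\<And>x y. f (x + y) = f x + f y" and "\<And>c x. f (c *\<^sub>C x) = c *\<^sub>C f x"
  shows "clinear f"
  using assms by (simp add: Vector_Spaces.linear_iff vector_space_pair_def cvec.vector_space_axioms)

lemma clinear_add: "clinear f \<Longrightarrow> f (x + y) = f x + f y"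
  by (simp add: Vector_Spaces.linear_iff)

lemma clinear_scaleC: "clinear f \<Longrightarrow> f (c *\<^sub>C x) = c *\<^sub>C f x"
  by (simp add: Vector_Spaces.linear_iff)

lemma clinear_diff: "clinear f \<Longrightarrow> f (x - y) = f x - f y"
  by (metis clinear_add add_diff_cancel diff_add_cancel)

lemma clinear_zero: "clinear f \<Longrightarrow> f 0 = 0"
  by (metis clinear_diff diff_self)

instantiation complex :: complex_vector
begin
definition scaleC_complex :: "complex \<Rightarrow> complex \<Rightarrow> complex" where
  "scaleC_complex = (*)"
instance by standard (simp_all add: scaleC_complex_def algebra_simps)
end

instantiation poly_mapping :: (type, complex_vector) complex_vector
begin
lift_definition scaleC_poly_mapping :: "complex \<Rightarrow> ('a \<Rightarrow>\<^sub>0 'b) \<Rightarrow> 'a \<Rightarrow>\<^sub>0 'b"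
  is "\<lambda>c f k. c *\<^sub>C f k"
  by (erule rev_finite_subset) (auto simp: cvec.scale_zero_right)
instance
  by standard
    (transfer, simp add: fun_eq_iff scaleC_add_right scaleC_add_left scaleC_scaleC scaleC_one)+
end

lemma lookup_scaleC [simp]: "Poly_Mapping.lookup (c *\<^sub>C p) k = c *\<^sub>C Poly_Mapping.lookup p k"
  by transfer simp

text \<open>
  The free vector space on \<^typ>\<open>'a\<close> is \<^typ>\<open>'a \<Rightarrow>\<^sub>0 complex\<close>, with basis
  \<^term>\<open>\<lambda>x. Poly_Mapping.single x (1::complex)\<close>.
\<close>

definition free_ext :: "('a \<Rightarrow> 'b::complex_vector) \<Rightarrow> ('a \<Rightarrow>\<^sub>0 complex) \<Rightarrow> 'b" where
  "free_ext g p = (\<Sum>x\<in>Poly_Mapping.keys p. Poly_Mapping.lookup p x *\<^sub>C g x)"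

lemma free_ext_superset:
  assumes "finite S" "Poly_Mapping.keys p \<subseteq> S"
  shows "free_ext g p = (\<Sum>x\<in>S. Poly_Mapping.lookup p x *\<^sub>C g x)"
  unfolding free_ext_def using assms
  by (intro sum.mono_neutral_left) (auto simp: in_keys_iff)

lemma clinear_free_ext: "clinear (free_ext g)"
proof (rule clinearI)
  fix p q :: "'a \<Rightarrow>\<^sub>0 complex" and c :: complex
  let ?S = "Poly_Mapping.keys p \<union> Poly_Mapping.keys q \<union> Poly_Mapping.keys (p + q)
    \<union> Poly_Mapping.keys (c *\<^sub>C p)"
  have e: "free_ext g r = (\<Sum>x\<in>?S. Poly_Mapping.lookup r x *\<^sub>C g x)"
    if "r \<in> {p, q, p + q, c *\<^sub>C p}" for r
    using that by (intro free_ext_superset) auto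
  show "free_ext g (p + q) = free_ext g p + free_ext g q"
    by (simp add: e lookup_add scaleC_add_left sum.distrib)
  show "free_ext g (c *\<^sub>C p) = c *\<^sub>C free_ext g p"
    by (simp add: e cvec.scale_sum_right scaleC_scaleC scaleC_complex_def)
qed

lemma free_ext_single [simp]: "free_ext g (Poly_Mapping.single x 1) = g x"
  by (simp add: free_ext_def scaleC_one)


section \<open>The symmetric algebra and the symmetric powers\<close>

abbreviation word :: "'v list \<Rightarrow> 'v list \<Rightarrow>\<^sub>0 complex" where
  "word xs \<equiv> Poly_Mapping.single xs 1"

text \<open>
  \<^term>\<open>word [v\<^sub>1, v\<^sub>2]\<close> stands for the formal product of its entries. The relations below
  impose multilinearity and commutativity. They are homogeneous in the length of the words, so
  the quotient is graded by length and its degree \<open>N\<close> part is the quotient of the free space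
  on \<open>V\<^sup>N\<close> by the relations between words of length \<open>N\<close>.
\<close>

definition sym_gens :: "('v::complex_vector list \<Rightarrow>\<^sub>0 complex) set" where
  "sym_gens =
     {word (xs[k := a + b]) - word (xs[k := a]) - word (xs[k := b]) |xs k a b. k < length xs}
   \<union> {word (xs[k := c *\<^sub>C a]) - c *\<^sub>C word (xs[k := a]) |xs k c a. k < length xs}
   \<union> {word xs - word ys |xs ys. mset xs = mset ys}"

definition sym_rel :: "('v::complex_vector list \<Rightarrow>\<^sub>0 complex) set" where
  "sym_rel = cvec.span sym_gens"

quotient_type (overloaded) 'v sym_alg = "'v::complex_vector list \<Rightarrow>\<^sub>0 complex" /
  "\<lambda>p q. p - q \<in> sym_rel"
proof (rule equivpI)
  show "reflp (\<lambda>p q :: 'v list \<Rightarrow>\<^sub>0 complex. p - q \<in> sym_rel)"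
    by (simp add: reflp_def sym_rel_def cvec.span_zero)
  have "q - p \<in> sym_rel" if "p - q \<in> sym_rel" for p q :: "'v list \<Rightarrow>\<^sub>0 complex"
    using cvec.span_neg[of "p - q"] that by (simp add: sym_rel_def)
  then show "symp (\<lambda>p q :: 'v list \<Rightarrow>\<^sub>0 complex. p - q \<in> sym_rel)"
    by (simp add: symp_def)
  have "p - r \<in> sym_rel" if "p - q \<in> sym_rel" "q - r \<in> sym_rel"
    for p q r :: "'v list \<Rightarrow>\<^sub>0 complex"
    using cvec.span_add[of "p - q" _ "q - r"] that by (simp add: sym_rel_def)
  then show "transp (\<lambda>p q :: 'v list \<Rightarrow>\<^sub>0 complex. p - q \<in> sym_rel)"
    unfolding transp_def by blast
qed

instantiation sym_alg :: (complex_vector) complex_vector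
begin

lift_definition zero_sym_alg :: "'a sym_alg" is 0 .

lift_definition plus_sym_alg :: "'a sym_alg \<Rightarrow> 'a sym_alg \<Rightarrow> 'a sym_alg" is "(+)"
proof -
  fix p p' q q' :: "'a list \<Rightarrow>\<^sub>0 complex"
  assume "p - p' \<in> sym_rel" "q - q' \<in> sym_rel"
  then show "(p + q) - (p' + q') \<in> sym_rel"
    using cvec.span_add[of "p - p'" _ "q - q'"] by (simp add: sym_rel_def add_diff_add)
qed

lift_definition uminus_sym_alg :: "'a sym_alg \<Rightarrow> 'a sym_alg" is uminus
proof -
  fix p p' :: "'a list \<Rightarrow>\<^sub>0 complex"
  assume "p - p' \<in> sym_rel"
  then show "- p - - p' \<in> sym_rel"
    using cvec.span_neg[of "p - p'"] by (simp add: sym_rel_def)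
qed

definition minus_sym_alg :: "'a sym_alg \<Rightarrow> 'a sym_alg \<Rightarrow> 'a sym_alg" where
  "minus_sym_alg s t = s + - t"

lift_definition scaleC_sym_alg :: "complex \<Rightarrow> 'a sym_alg \<Rightarrow> 'a sym_alg" is scaleC
proof -
  fix c and p p' :: "'a list \<Rightarrow>\<^sub>0 complex"
  assume "p - p' \<in> sym_rel"
  then show "c *\<^sub>C p - c *\<^sub>C p' \<in> sym_rel"
    using cvec.span_scale[of "p - p'"] by (simp add: sym_rel_def cvec.scale_right_diff_distrib)
qed

instance
proof
  fix r s t :: "'a sym_alg" and a b :: complex
  note simps = sym_rel_def cvec.span_zero
  show "r + s + t = r + (s + t)" by transfer (simp add: simps add.assoc)
  show "r + s = s + r" by transfer (simp add: simps add.commute)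
  show "0 + r = r" by transfer (simp add: simps)
  show "- r + r = 0" by transfer (simp add: simps)
  show "r - s = r + - s" by (simp add: minus_sym_alg_def)
  show "a *\<^sub>C (r + s) = a *\<^sub>C r + a *\<^sub>C s" by transfer (simp add: simps scaleC_add_right)
  show "(a + b) *\<^sub>C r = a *\<^sub>C r + b *\<^sub>C r" by transfer (simp add: simps scaleC_add_left)
  show "a *\<^sub>C (b *\<^sub>C r) = (a * b) *\<^sub>C r" by transfer (simp add: simps scaleC_scaleC)
  show "1 *\<^sub>C r = r" by transfer (simp add: simps scaleC_one)
qed

end

text \<open>The product of the vectors of a list in the symmetric algebra.\<close>

lift_definition sym_prod :: "'v::complex_vector list \<Rightarrow> 'v sym_alg" is word .

definition sym_power :: "nat \<Rightarrow> 'v::complex_vector sym_alg set" where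
  "sym_power N = cvec.span {sym_prod xs |xs. length xs = N}"

text \<open>
  A linear map of the vector space extends to a derivation of its symmetric algebra. It is
  defined through an arbitrary representative; for a linear map the choice is irrelevant, as
  \<open>sym_der_sym_prod\<close> and \<open>clinear_sym_der\<close> show.
\<close>

definition word_der :: "('v \<Rightarrow> 'v::complex_vector) \<Rightarrow> ('v list \<Rightarrow>\<^sub>0 complex) \<Rightarrow> 'v list \<Rightarrow>\<^sub>0 complex"
  where "word_der T = free_ext (\<lambda>xs. \<Sum>i<length xs. word (xs[i := T (xs ! i)]))"

definition sym_der :: "('v \<Rightarrow> 'v::complex_vector) \<Rightarrow> 'v sym_alg \<Rightarrow> 'v sym_alg" where
  "sym_der T s = abs_sym_alg (word_der T (rep_sym_alg s))"

lemma sym_gens_add: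
  "k < length xs \<Longrightarrow>
    word (xs[k := a + b]) - word (xs[k := a]) - word (xs[k := b]) \<in> sym_gens"
  unfolding sym_gens_def by blast

lemma sym_gens_scale:
  "k < length xs \<Longrightarrow> word (xs[k := c *\<^sub>C a]) - c *\<^sub>C word (xs[k := a]) \<in> sym_gens"
  unfolding sym_gens_def by blast

lemma sym_gens_perm: "mset xs = mset ys \<Longrightarrow> word xs - word ys \<in> sym_gens"
  unfolding sym_gens_def by blast

lemma word_der_gens:
  assumes T: "clinear T" and r: "r \<in> sym_gens"
  shows "word_der T r \<in> sym_rel"
proof -
  define g where "g = (\<lambda>xs. \<Sum>i<length xs. word (xs[i := T (xs ! i)]))"
  have W: "word_der T = free_ext g" by (simp add: word_der_def g_def)
  note lin = clinear_diff[OF clinear_free_ext] clinear_scaleC[OF clinear_free_ext]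
  define u where "u = (\<lambda>xs k i c. if i = k then word (xs[k := T c])
     else word (xs[i := T (xs ! i), k := c]))"
  have upd: "g (xs[k := c]) = (\<Sum>i<length xs. u xs k i c)" if "k < length xs" for xs k c
    unfolding g_def u_def using that
    by (auto intro!: sum.cong simp: list_update_swap)
  from r consider
      (add) xs k a b where "k < length xs"
        "r = word (xs[k := a + b]) - word (xs[k := a]) - word (xs[k := b])"
    | (scale) xs k c a where "k < length xs"
        "r = word (xs[k := c *\<^sub>C a]) - c *\<^sub>C word (xs[k := a])"
    | (perm) xs ys where "mset xs = mset ys" "r = word xs - word ys"
    unfolding sym_gens_def by blast
  then show ?thesis
  proof cases
    case add
    have *: "u xs k i (a + b) - u xs k i a - u xs k i b \<in> sym_gens" if "i < length xs" for i
      using add(1) sym_gens_add[of k xs] sym_gens_add[of k "xs[i := T (xs ! i)]"]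
      by (cases "i = k") (simp_all add: u_def clinear_add[OF T])
    have "word_der T r = (\<Sum>i<length xs. u xs k i (a + b) - u xs k i a - u xs k i b)"
      by (simp add: W add(2) lin upd[OF add(1)] sum_subtractf)
    also have "\<dots> \<in> sym_rel" unfolding sym_rel_def
      by (intro cvec.span_sum cvec.span_base *) simp
    finally show ?thesis .
  next
    case scale
    have *: "u xs k i (c *\<^sub>C a) - c *\<^sub>C u xs k i a \<in> sym_gens" if "i < length xs" for i
      using scale(1) sym_gens_scale[of k xs] sym_gens_scale[of k "xs[i := T (xs ! i)]"]
      by (cases "i = k") (simp_all add: u_def clinear_scaleC[OF T])
    have "word_der T r = (\<Sum>i<length xs. u xs k i (c *\<^sub>C a) - c *\<^sub>C u xs k i a)"
      by (simp add: W scale(2) lin upd[OF scale(1)] sum_subtractf cvec.scale_sum_right)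
    also have "\<dots> \<in> sym_rel" unfolding sym_rel_def
      by (intro cvec.span_sum cvec.span_base *) simp
    finally show ?thesis .
  next
    case perm
    from perm(1) obtain p where p: "p permutes {..<length ys}" "permute_list p ys = xs"
      by (rule mset_eq_permutation)
    have len: "length xs = length ys" using perm(1) by (rule mset_eq_length)
    have nth: "xs ! i = ys ! p i" if "i < length ys" for i
      using p that by (metis permute_list_nth)
    have "g ys = (\<Sum>i<length ys. word (ys[p i := T (ys ! p i)]))"
      unfolding g_def by (rule sum.permute[OF p(1), unfolded o_def])
    then have "word_der T r =
        (\<Sum>i<length ys. word (xs[i := T (xs ! i)]) - word (ys[p i := T (ys ! p i)]))"
      by (simp add: W perm(2) lin sum_subtractf) (simp add: g_def len)
    also have "\<dots> \<in> sym_rel" unfolding sym_rel_def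
    proof (intro cvec.span_sum cvec.span_base)
      fix i assume "i \<in> {..<length ys}"
      then have i: "i < length ys" and pi: "p i < length ys"
        using permutes_in_image[OF p(1)] by auto
      have "mset (xs[i := T (xs ! i)]) = mset (ys[p i := T (ys ! p i)])"
        using i pi by (simp add: mset_update len nth perm(1))
      then show "word (xs[i := T (xs ! i)]) - word (ys[p i := T (ys ! p i)]) \<in> sym_gens"
        by (rule sym_gens_perm)
    qed
    finally show ?thesis .
  qed
qed

lemma word_der_rel:
  assumes T: "clinear T" and r: "r \<in> sym_rel"
  shows "word_der T r \<in> sym_rel"
proof -
  note lin = clinear_free_ext[of "\<lambda>xs. \<Sum>i<length xs. word (xs[i := T (xs ! i)])",
    folded word_der_def]
  from r have "r \<in> cvec.span sym_gens" by (simp add: sym_rel_def)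
  then show ?thesis
  proof (induction rule: cvec.span_induct_alt)
    case base
    then show ?case by (simp add: clinear_zero[OF lin] sym_rel_def cvec.span_zero)
  next
    case (step c x y)
    then show ?case using word_der_gens[OF T, of x]
      by (simp add: clinear_add[OF lin] clinear_scaleC[OF lin] sym_rel_def cvec.span_add
          cvec.span_scale)
  qed
qed

lemma sym_der_abs:
  assumes "clinear T"
  shows "sym_der T (abs_sym_alg p) = abs_sym_alg (word_der T p)"
proof -
  note lin = clinear_free_ext[of "\<lambda>xs. \<Sum>i<length xs. word (xs[i := T (xs ! i)])",
    folded word_der_def]
  have "rep_sym_alg (abs_sym_alg p) - p \<in> sym_rel"
    using rep_abs_rsp_left[OF Quotient3_sym_alg, of p p] by (simp add: sym_rel_def cvec.span_zero)
  then have "word_der T (rep_sym_alg (abs_sym_alg p)) - word_der T p \<in> sym_rel"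
    using word_der_rel[OF assms] by (simp add: clinear_diff[OF lin, symmetric])
  then show ?thesis by (simp add: sym_der_def sym_alg.abs_eq_iff)
qed

lemma clinear_abs_sym_alg: "clinear abs_sym_alg"
  by (rule clinearI) (simp_all add: plus_sym_alg.abs_eq scaleC_sym_alg.abs_eq)

lemma abs_sym_alg_sum: "abs_sym_alg (\<Sum>i\<in>I. f i) = (\<Sum>i\<in>I. abs_sym_alg (f i))"
  by (induction I rule: infinite_finite_induct)
    (simp_all add: clinear_zero[OF clinear_abs_sym_alg] clinear_add[OF clinear_abs_sym_alg])

lemma sym_der_sym_prod:
  assumes "clinear T"
  shows "sym_der T (sym_prod xs) = (\<Sum>i<length xs. sym_prod (xs[i := T (xs ! i)]))"
  by (simp add: sym_prod.abs_eq sym_der_abs[OF assms] word_der_def abs_sym_alg_sum)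

lemma clinear_sym_der:
  fixes T :: "'a \<Rightarrow> 'a::complex_vector"
  assumes "clinear T"
  shows "clinear (sym_der T)"
proof (rule clinearI)
  note lin = clinear_free_ext[of "\<lambda>xs. \<Sum>i<length xs. word (xs[i := T (xs ! i)])",
    folded word_der_def]
  fix s t :: "'a sym_alg" and c :: complex
  obtain p where [simp]: "s = abs_sym_alg p"
    using Quotient3_abs_rep[OF Quotient3_sym_alg, of s] by metis
  obtain q where [simp]: "t = abs_sym_alg q"
    using Quotient3_abs_rep[OF Quotient3_sym_alg, of t] by metis
  show "sym_der T (s + t) = sym_der T s + sym_der T t"
    by (simp add: plus_sym_alg.abs_eq sym_der_abs[OF assms] clinear_add[OF lin])
  show "sym_der T (c *\<^sub>C s) = c *\<^sub>C sym_der T s"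
    by (simp add: scaleC_sym_alg.abs_eq sym_der_abs[OF assms] clinear_scaleC[OF lin])
qed


section \<open>Representations of \<open>sl(2, C)\<close>\<close>

definition sl2 :: "(complex^2^2) set" where
  "sl2 = {X. trace X = 0}"

definition lie_bracket :: "complex^2^2 \<Rightarrow> complex^2^2 \<Rightarrow> complex^2^2" where
  "lie_bracket X Y = X ** Y - Y ** X"

definition sl2_H :: "complex^2^2" where
  "sl2_H = vector [vector [1, 0], vector [0, -1]]"

definition sl2_E :: "complex^2^2" where
  "sl2_E = vector [vector [0, 1], vector [0, 0]]"

text \<open>\<^term>\<open>mat c ** X\<close> is the scalar multiple of the matrix \<^term>\<open>X\<close> by \<^term>\<open>c\<close>.\<close>

definition sl2_rep :: "(complex^2^2 \<Rightarrow> 'v \<Rightarrow> 'v::complex_vector) \<Rightarrow> bool" where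
  "sl2_rep \<rho> \<longleftrightarrow>
     (\<forall>X\<in>sl2. clinear (\<rho> X))
   \<and> (\<forall>X\<in>sl2. \<forall>Y\<in>sl2. \<forall>v. \<rho> (X + Y) v = \<rho> X v + \<rho> Y v)
   \<and> (\<forall>c. \<forall>X\<in>sl2. \<forall>v. \<rho> (mat c ** X) v = c *\<^sub>C \<rho> X v)
   \<and> (\<forall>X\<in>sl2. \<forall>Y\<in>sl2. \<forall>v. \<rho> (lie_bracket X Y) v = \<rho> X (\<rho> Y v) - \<rho> Y (\<rho> X v))"

definition sl2_irreducible :: "(complex^2^2 \<Rightarrow> 'v \<Rightarrow> 'v::complex_vector) \<Rightarrow> bool" where
  "sl2_irreducible \<rho> \<longleftrightarrow>
     sl2_rep \<rho> \<and> (\<exists>v::'v. v \<noteq> 0)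
   \<and> (\<forall>W. cvec.subspace W \<and> (\<forall>X\<in>sl2. \<rho> X ` W \<subseteq> W) \<longrightarrow> W = {0} \<or> W = UNIV)"

text \<open>
  The fundamental weight takes the value \<open>1\<close> on \<^term>\<open>sl2_H\<close>, so a vector has weight
  \<open>c \<omega>\<^sub>1\<close> iff it is multiplied by \<^term>\<open>c\<close> under \<^term>\<open>sl2_H\<close>.
\<close>

definition highest_weight :: "(complex^2^2 \<Rightarrow> 'v \<Rightarrow> 'v::complex_vector) \<Rightarrow> nat \<Rightarrow> bool" where
  "highest_weight \<rho> m \<longleftrightarrow> (\<exists>v. v \<noteq> 0 \<and> \<rho> sl2_E v = 0 \<and> \<rho> sl2_H v = of_nat m *\<^sub>C v)"

definition sym_action ::
    "(complex^2^2 \<Rightarrow> 'v \<Rightarrow> 'v::complex_vector) \<Rightarrow> complex^2^2 \<Rightarrow> 'v sym_alg \<Rightarrow> 'v sym_alg" where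
  "sym_action \<rho> X = sym_der (\<rho> X)"


section \<open>Characters as elements of the field of rational functions\<close>

text \<open>In the next two definitions \<^term>\<open>W\<close> is an invariant subspace of \<^term>\<open>\<rho>\<close>.\<close>

definition weight_mult ::
    "'v::complex_vector set \<Rightarrow> (complex^2^2 \<Rightarrow> 'v \<Rightarrow> 'v) \<Rightarrow> int \<Rightarrow> nat" where
  "weight_mult W \<rho> c = cvec.dim {v \<in> W. \<rho> sl2_H v = of_int c *\<^sub>C v}"

definition qvar :: "complex poly fract" where
  "qvar = Fract [:0, 1:] 1"

definition sl2_char ::
    "'v::complex_vector set \<Rightarrow> (complex^2^2 \<Rightarrow> 'v \<Rightarrow> 'v) \<Rightarrow> complex poly fract" where
  "sl2_char W \<rho> = (\<Sum>c | weight_mult W \<rho> c \<noteq> 0. of_nat (weight_mult W \<rho> c) * qvar powi c)"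

text \<open>\<^term>\<open>A_coeff m i\<close> is \<open>A\<^bsub>m-2i,1\<^esub>\<close>, for \<^term>\<open>i \<le> m\<close>.\<close>

definition A_coeff :: "nat \<Rightarrow> nat \<Rightarrow> complex poly fract" where
  "A_coeff m i = (-1) ^ i * qvar powi ((int m - int i) * (int m - int i + 1))
     * (\<Prod>j\<in>{0..m} - {i}. 1 / (qvar powi (2 * \<bar>int i - int j\<bar>) - 1))"

end

theory Submission
  imports Defs
begin

text \<open>
  The character is a complete homogeneous symmetric polynomial. Let \<open>v\<close> be a highest weight vector
  and \<open>F\<close> the lowering operator. The vectors \<open>F\<^sup>i v\<close> with \<open>i \<le> m\<close> form a basis of the irreducible
  representation, and \<open>F\<^sup>i v\<close> has weight \<open>m - 2i\<close> (\<open>irreducible_weight_basis\<close>). The products of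
  \<open>N\<close> basis vectors, one for each multiset of size \<open>N\<close>, form a basis of the \<open>N\<close>-th symmetric
  power (\<open>sym_power_eq_span\<close>, \<open>sym_monom_basis\<close>), and weights add up under products. Hence the
  character is \<open>h\<^sub>N(x\<^sub>0, \<dots>, x\<^sub>m)\<close> with \<open>x\<^sub>i = q\<^bsup>m-2i\<^esup>\<close> (\<open>sl2_char_sym_power\<close>).

  For distinct \<open>x\<^sub>i\<close> in a field, \<open>h\<^sub>N\<close> is the sum over \<open>i\<close> of \<open>x\<^sub>i\<^sup>N\<close> times the product of
  \<open>x\<^sub>i / (x\<^sub>i - x\<^sub>j)\<close> over \<open>j \<noteq> i\<close> (\<open>complete_homogeneous_eq_lagrange_sum\<close>); this is the partial
  fraction expansion of the generating function \<open>1 / \<Prod>\<^sub>i (1 - x\<^sub>i t)\<close>, proved here by a recurrence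
  in the set of variables. At \<open>x\<^sub>i = q\<^bsup>m-2i\<^esup>\<close> the product is \<open>A\<^bsub>m-2i,1\<^esub>\<close>
  (\<open>A_coeff_eq_lagrange_factor\<close>).

  The one point that needs an auxiliary construction is the independence of the products of basis
  vectors in the symmetric algebra, a quotient by relations. It is seen by mapping the symmetric
  algebra linearly to a polynomial ring, where these products become distinct monomials
  (\<open>sym_monom_to_monomial\<close>).
\<close>


section \<open>Complete homogeneous symmetric polynomials\<close>

definition complete_homogeneous :: "('i \<Rightarrow> 'a::comm_semiring_1) \<Rightarrow> 'i set \<Rightarrow> nat \<Rightarrow> 'a" where
  "complete_homogeneous x D N = (\<Sum>M\<in>multisets_of_size D N. \<Prod>b\<in>#M. x b)"

text \<open>
  A multiset of size \<open>N + 1\<close> either avoids \<open>a\<close> or arises in one way by adding \<open>a\<close> to a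
  multiset of size \<open>N\<close>.
\<close>

lemma complete_homogeneous_Suc:
  assumes "finite D" "a \<in> D"
  shows "complete_homogeneous x D (Suc N) =
    complete_homogeneous x (D - {a}) (Suc N) + x a * complete_homogeneous x D N"
proof -
  have split: "multisets_of_size D (Suc N) =
      multisets_of_size (D - {a}) (Suc N) \<union> add_mset a ` multisets_of_size D N" (is "_ = ?U \<union> ?V")
  proof (intro equalityI subsetI)
    fix M assume M: "M \<in> multisets_of_size D (Suc N)"
    show "M \<in> ?U \<union> ?V"
    proof (cases "a \<in># M")
      case True
      then obtain M' where "M = add_mset a M'" by (metis multi_member_split)
      with M show ?thesis by (auto simp: multisets_of_size_def)
    qed (use M in \<open>auto simp: multisets_of_size_def\<close>)
  qed (use assms in \<open>auto simp: multisets_of_size_def\<close>)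
  have disj: "?U \<inter> ?V = {}" by (auto simp: multisets_of_size_def)
  have inj: "inj_on (add_mset a) (multisets_of_size D N)" by (simp add: inj_on_def)
  show ?thesis
    unfolding complete_homogeneous_def split
    by (subst sum.union_disjoint[OF _ _ disj])
       (use assms in \<open>simp_all add: finite_multisets_of_size sum.reindex[OF inj] sum_distrib_left\<close>)
qed

lemma complete_homogeneous_singleton: "complete_homogeneous x {a} N = x a ^ N"
proof -
  have "multisets_of_size {a} N = {replicate_mset N a}"
  proof (intro equalityI subsetI)
    fix M assume "M \<in> multisets_of_size {a} N"
    then show "M \<in> {replicate_mset N a}"
      using set_mset_subset_singletonD by (auto simp: multisets_of_size_def)
  qed (auto simp: multisets_of_size_def)
  then show ?thesis by (simp add: complete_homogeneous_def)
qed

text \<open>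
  The sum that will be seen to equal \<open>h\<^sub>N\<close> satisfies the same recurrence: in the difference of
  the two sums over \<open>D\<close> the summand of \<open>b\<close> carries a factor \<open>x b - x a\<close>, which removes the
  summand \<open>b = a\<close> and cancels the factor \<open>j = a\<close> of the denominator in the others.
\<close>

lemma lagrange_sum_Suc:
  fixes x :: "'i \<Rightarrow> 'a::field"
  assumes "finite D" "a \<in> D" "inj_on x D"
  shows "(\<Sum>b\<in>D. x b ^ Suc N * (\<Prod>j\<in>D - {b}. x b / (x b - x j))) =
     (\<Sum>b\<in>D - {a}. x b ^ Suc N * (\<Prod>j\<in>D - {a} - {b}. x b / (x b - x j)))
     + x a * (\<Sum>b\<in>D. x b ^ N * (\<Prod>j\<in>D - {b}. x b / (x b - x j)))"
proof -
  let ?r = "\<lambda>D b. \<Prod>j\<in>D - {b}. x b / (x b - x j)"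
  have "(\<Sum>b\<in>D. x b ^ Suc N * ?r D b) - x a * (\<Sum>b\<in>D. x b ^ N * ?r D b)
      = (\<Sum>b\<in>D. x b ^ N * (x b - x a) * ?r D b)"
    by (simp add: sum_distrib_left sum_subtractf[symmetric] algebra_simps)
  also have "\<dots> = (\<Sum>b\<in>D - {a}. x b ^ N * (x b - x a) * ?r D b)"
    using assms by (subst sum.remove[OF assms(1,2)]) simp
  also have "\<dots> = (\<Sum>b\<in>D - {a}. x b ^ Suc N * ?r (D - {a}) b)"
  proof (rule sum.cong[OF refl])
    fix b assume b: "b \<in> D - {a}"
    then have b_ne: "a \<noteq> b" and ne: "x b - x a \<noteq> 0" using assms by (auto simp: inj_on_def)
    have "?r D b = x b / (x b - x a) * ?r (D - {a}) b"
      using prod.remove[of "D - {b}" a "\<lambda>j. x b / (x b - x j)"] assms b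
      by (simp add: Diff_insert2[symmetric] insert_commute b_ne)
    then show "x b ^ N * (x b - x a) * ?r D b = x b ^ Suc N * ?r (D - {a}) b"
      using ne by simp
  qed
  finally show ?thesis by (simp add: algebra_simps)
qed

text \<open>
  The recurrence for a single \<open>a\<close> relates the values at \<open>N + 1\<close> and \<open>N\<close> on \<open>D\<close> and so needs an
  initial value at \<open>N = 0\<close>, which for the right-hand side is not obvious. Using it for two
  elements \<open>a \<noteq> b\<close> eliminates the value at \<open>N + 1\<close> and leaves
  \<open>(x a - x b) h\<^sub>N(D) = h\<^bsub>N+1\<^esub>(D - {b}) - h\<^bsub>N+1\<^esub>(D - {a})\<close>. Thus both sides are
  determined for all \<open>N\<close> at once by their values on smaller sets, down to singletons, where both
  are \<open>x a ^ N\<close>.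
\<close>

lemma complete_homogeneous_eq_lagrange_sum:
  fixes x :: "'i \<Rightarrow> 'a::field"
  assumes "finite D" "D \<noteq> {}" "inj_on x D"
  shows "complete_homogeneous x D N = (\<Sum>b\<in>D. x b ^ N * (\<Prod>j\<in>D - {b}. x b / (x b - x j)))"
  using assms
proof (induction "card D" arbitrary: D N rule: less_induct)
  case less
  define R where "R D N = (\<Sum>b\<in>D. x b ^ N * (\<Prod>j\<in>D - {b}. x b / (x b - x j)))" for D N
  let ?h = "complete_homogeneous x"
  from less.prems obtain a where a: "a \<in> D" by auto
  show ?case
  proof (cases "D = {a}")
    case True
    then show ?thesis by (simp add: complete_homogeneous_singleton)
  next
    case False
    with a obtain b where b: "b \<in> D" "b \<noteq> a" by auto
    have smaller: "?h (D - {c}) M = R (D - {c}) M" if "c \<in> D" "d \<in> D" "d \<noteq> c" for c d M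
      unfolding R_def using less.prems that
      by (intro less.hyps psubset_card_mono) (auto intro: inj_on_subset)
    have h: "?h D (Suc N) = R (D - {c}) (Suc N) + x c * ?h D N" if "c \<in> {a, b}" for c
      using complete_homogeneous_Suc[of D c x N] smaller[of c] less.prems that a b by auto
    have R: "R D (Suc N) = R (D - {c}) (Suc N) + x c * R D N" if "c \<in> {a, b}" for c
      using lagrange_sum_Suc[of D c x N] less.prems that a b unfolding R_def by auto
    have "(x a - x b) * ?h D N = R (D - {b}) (Suc N) - R (D - {a}) (Suc N)"
      using trans[OF h[of a, symmetric] h[of b]] by (simp add: algebra_simps)
    also have "\<dots> = (x a - x b) * R D N"
      using trans[OF R[of a, symmetric] R[of b]] by (simp add: algebra_simps)
    finally have "(x a - x b) * ?h D N = (x a - x b) * R D N" .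
    moreover have "x a \<noteq> x b" using less.prems a b by (auto simp: inj_on_def)
    ultimately show ?thesis by (simp add: R_def)
  qed
qed


section \<open>The rational functions in the character formula\<close>

lemma qvar_nonzero [simp]: "qvar \<noteq> 0"
  by (simp add: qvar_def Zero_fract_def eq_fract)

lemma qvar_power: "qvar ^ n = Fract (monom 1 n) 1"
  by (induction n) (simp_all add: qvar_def fract_collapse monom_Suc)

lemma qvar_powi_eq_1_iff: "qvar powi k = 1 \<longleftrightarrow> k = 0"
proof -
  have "qvar ^ n = 1 \<longleftrightarrow> n = 0" for n
    unfolding qvar_power One_fract_def by (simp add: eq_fract monom_eq_1_iff)
  then show ?thesis by (simp add: power_int_def power_inverse)
qed

lemma prod_qvar_above:
  assumes "i \<le> m"
  shows "(\<Prod>j\<in>{i<..m}. qvar powi (2 * (int j - int i)))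
    = qvar powi ((int m - int i) * (int m - int i + 1))"
  using assms
proof (induction m rule: dec_induct)
  case (step m)
  have "{i<..Suc m} = insert (Suc m) {i<..m}" using step.hyps by auto
  then have "(\<Prod>j\<in>{i<..Suc m}. qvar powi (2 * (int j - int i))) =
      qvar powi (2 * (int (Suc m) - int i)) * (\<Prod>j\<in>{i<..m}. qvar powi (2 * (int j - int i)))"
    by simp
  also have "(\<Prod>j\<in>{i<..m}. qvar powi (2 * (int j - int i))) =
      qvar powi ((int m - int i) * (int m - int i + 1))"
    by (rule step.IH)
  also have "qvar powi (2 * (int (Suc m) - int i)) * qvar powi ((int m - int i) * (int m - int i + 1))
      = qvar powi (2 * (int (Suc m) - int i) + (int m - int i) * (int m - int i + 1))"
    by (simp only: power_int_add[OF disjI1[OF qvar_nonzero]])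
  also have "2 * (int (Suc m) - int i) + (int m - int i) * (int m - int i + 1) =
      (int (Suc m) - int i) * (int (Suc m) - int i + 1)"
    by (simp add: algebra_simps)
  finally show ?case .
qed simp

text \<open>
  With \<open>x\<^sub>j = q\<^bsup>m-2j\<^esup>\<close> the quotient \<open>x\<^sub>j / x\<^sub>i\<close> is \<open>q\<^bsup>2(i-j)\<^esup>\<close>. Writing each factor with
  the denominator \<open>q\<^bsup>2|i-j|\<^esup> - 1\<close> leaves the numerator \<open>-1\<close> for each of the \<open>i\<close> indices
  \<open>j < i\<close>, and \<open>q\<^bsup>2(j-i)\<^esup>\<close> for \<open>j > i\<close>; the latter multiply to the power of \<open>q\<close> in front of
  the product in \<^const>\<open>A_coeff\<close>.
\<close>

lemma A_coeff_eq_lagrange_factor: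
  fixes m i :: nat
  defines "x \<equiv> \<lambda>j. qvar powi (int m - 2 * int j)"
  assumes "i \<le> m"
  shows "A_coeff m i = (\<Prod>j\<in>{0..m} - {i}. x i / (x i - x j))"
proof -
  let ?d = "\<lambda>j. 1 / (qvar powi (2 * \<bar>int i - int j\<bar>) - 1)"
  let ?s = "\<lambda>j. if j < i then -1 else qvar powi (2 * (int j - int i))"
  have below: "a / (a - a * y) = -1 * (1 / (y - 1))"
    and above: "a * y / (a * y - a) = y * (1 / (y - 1))"
    if "a \<noteq> 0" "y \<noteq> 1" for a y :: "complex poly fract"
  proof -
    have "a - a * y = a * - (y - 1)" "a * y - a = a * (y - 1)" by (simp_all add: algebra_simps)
    with that show "a / (a - a * y) = -1 * (1 / (y - 1))" "a * y / (a * y - a) = y * (1 / (y - 1))"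
      by (simp_all del: minus_diff_eq)
  qed
  have x_nz: "x k \<noteq> 0" for k by (simp add: x_def)
  have shift: "x k = x l * qvar powi (2 * (int l - int k))" for k l
    by (simp add: x_def algebra_simps flip: power_int_add)
  have factor: "x i / (x i - x j) = ?s j * ?d j" if "j \<noteq> i" for j
  proof (cases "j < i")
    case True
    then have "qvar powi (2 * (int i - int j)) \<noteq> 1" by (simp add: qvar_powi_eq_1_iff)
    from below[OF x_nz this, of i, folded shift[of j i]] show ?thesis
      using True by simp
  next
    case False
    with that have "qvar powi (2 * (int j - int i)) \<noteq> 1" by (simp add: qvar_powi_eq_1_iff)
    from above[OF x_nz this, of j, folded shift[of i j]] show ?thesis
      using False by simp
  qed
  have "(\<Prod>j\<in>{0..m} - {i}. ?s j) = (\<Prod>j\<in>{..<i}. ?s j) * (\<Prod>j\<in>{i<..m}. ?s j)"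
    using assms(2) by (subst prod.union_disjoint[symmetric]) (auto intro!: prod.cong)
  also have "(\<Prod>j\<in>{..<i}. ?s j) = (-1) ^ i"
    by simp
  also have "(\<Prod>j\<in>{i<..m}. ?s j) = qvar powi ((int m - int i) * (int m - int i + 1))"
    unfolding prod_qvar_above[OF assms(2), symmetric] by (intro prod.cong) auto
  finally have "A_coeff m i = (\<Prod>j\<in>{0..m} - {i}. ?s j) * (\<Prod>j\<in>{0..m} - {i}. ?d j)"
    by (simp add: A_coeff_def)
  also have "\<dots> = (\<Prod>j\<in>{0..m} - {i}. x i / (x i - x j))"
    unfolding prod.distrib[symmetric] by (intro prod.cong) (simp_all add: factor del: prod.distrib)
  finally show ?thesis .
qed


section \<open>Eigenvectors of linear maps\<close>

lemma clinear_sum: "clinear f \<Longrightarrow> f (\<Sum>i\<in>I. g i) = (\<Sum>i\<in>I. f (g i))"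
  by (induction I rule: infinite_finite_induct) (simp_all add: clinear_zero clinear_add)

text \<open>
  Applying \<open>L - \<mu> j\<close> to a vanishing sum of eigenvectors kills the summand \<open>j\<close> and multiplies
  the others by nonzero scalars, so a shorter sum vanishes.
\<close>

lemma eigenvectors_sum_eq_0:
  assumes L: "clinear L" and "finite I" "inj_on \<mu> I"
    and "\<And>i. i \<in> I \<Longrightarrow> L (f i) = \<mu> i *\<^sub>C f i"
    and "(\<Sum>i\<in>I. f i) = 0"
  shows "\<forall>i\<in>I. f i = 0"
  using assms(2-)
proof (induction I arbitrary: f rule: finite_induct)
  case (insert j I)
  have "(\<Sum>i\<in>I. (\<mu> i - \<mu> j) *\<^sub>C f i) = (\<Sum>i\<in>insert j I. (\<mu> i - \<mu> j) *\<^sub>C f i)"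
    using insert.hyps by simp
  also have "\<dots> = L (\<Sum>i\<in>insert j I. f i) - \<mu> j *\<^sub>C (\<Sum>i\<in>insert j I. f i)"
    unfolding clinear_sum[OF L] cvec.scale_sum_right sum_subtractf[symmetric]
    by (rule sum.cong) (simp_all add: insert.prems(2) cvec.scale_left_diff_distrib)
  also have "\<dots> = 0"
    unfolding insert.prems(3) by (simp add: clinear_zero[OF L])
  finally have "\<forall>i\<in>I. (\<mu> i - \<mu> j) *\<^sub>C f i = 0"
    using insert.prems(1,2) clinear_scaleC[OF L]
    by (intro insert.IH) (auto simp: scaleC_scaleC mult.commute)
  then have "\<forall>i\<in>I. f i = 0"
    using insert.prems(1) insert.hyps by (auto simp: inj_on_def)
  then show ?case using insert.prems(3) insert.hyps by simp
qed simp

text \<open>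
  The eigenvectors are given as a family because the eigenvalue is then a function of the index;
  \<open>I\<close> may be infinite.
\<close>

lemma eigenvectors_independent:
  assumes L: "clinear L" and \<mu>: "inj_on \<mu> I"
    and nz: "\<And>i. i \<in> I \<Longrightarrow> f i \<noteq> 0" and eig: "\<And>i. i \<in> I \<Longrightarrow> L (f i) = \<mu> i *\<^sub>C f i"
  shows "inj_on f I" and "cvec.independent (f ` I)"
proof -
  show inj: "inj_on f I"
  proof (rule inj_onI)
    fix i j assume ij: "i \<in> I" "j \<in> I" "f i = f j"
    then have "\<mu> i *\<^sub>C f i = \<mu> j *\<^sub>C f i" using eig[of i] eig[of j] by metis
    with ij \<mu> nz[of i] show "i = j" by (simp add: inj_on_eq_iff)
  qed
  show "cvec.independent (f ` I)"
    unfolding cvec.independent_explicit_finite_subsets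
  proof (intro allI impI ballI)
    fix F u v assume F: "F \<subseteq> f ` I" "finite F" "(\<Sum>v\<in>F. u v *\<^sub>C v) = 0" "v \<in> F"
    then obtain J where J: "J \<subseteq> I" "finite J" "F = f ` J"
      using finite_subset_image[OF F(2,1)] by blast
    have "(\<Sum>j\<in>J. u (f j) *\<^sub>C f j) = 0"
      using F(3) inj_on_subset[OF inj J(1)] by (simp add: J(3) sum.reindex)
    moreover have "L (u (f j) *\<^sub>C f j) = \<mu> j *\<^sub>C u (f j) *\<^sub>C f j" if "j \<in> J" for j
      using that J(1) eig by (simp add: clinear_scaleC[OF L] scaleC_scaleC mult.commute subset_iff)
    ultimately have "\<forall>j\<in>J. u (f j) *\<^sub>C f j = 0"
      using J(2) inj_on_subset[OF \<mu> J(1)] by (intro eigenvectors_sum_eq_0[OF L, of J \<mu>])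
    moreover obtain j where "j \<in> J" "v = f j" using F(4) J(3) by blast
    ultimately show "u v = 0" using nz[of j] J(1) by auto
  qed
qed

text \<open>
  On the coordinates with respect to an eigenbasis, \<open>L - c\<close> multiplies the coordinate at \<open>x\<close> by
  \<open>\<mu> x - c\<close>; its kernel consists of the vectors whose coordinates live where this scalar
  vanishes.
\<close>

lemma eigenspace_span:
  assumes L: "clinear L" and S: "finite S" "cvec.independent S"
    and eig: "\<And>x. x \<in> S \<Longrightarrow> L x = \<mu> x *\<^sub>C x"
  shows "{v \<in> cvec.span S. L v = c *\<^sub>C v} = cvec.span {x \<in> S. \<mu> x = c}"
proof (intro equalityI subsetI)
  fix v assume "v \<in> {v \<in> cvec.span S. L v = c *\<^sub>C v}"
  then obtain u where v: "v = (\<Sum>x\<in>S. u x *\<^sub>C x)" and Lv: "L v = c *\<^sub>C v"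
    by (auto simp: cvec.span_finite[OF S(1)])
  have "(\<Sum>x\<in>S. (u x * (\<mu> x - c)) *\<^sub>C x) = L v - c *\<^sub>C v"
    unfolding v clinear_sum[OF L] cvec.scale_sum_right sum_subtractf[symmetric]
    by (rule sum.cong)
       (simp_all add: eig clinear_scaleC[OF L] scaleC_scaleC cvec.scale_left_diff_distrib algebra_simps)
  then have "\<forall>x\<in>S. u x * (\<mu> x - c) = 0"
    using S(2)[unfolded cvec.independent_explicit_finite_subsets, rule_format,
        OF order_refl S(1), of "\<lambda>x. u x * (\<mu> x - c)"] Lv by simp
  then have "v = (\<Sum>x | x \<in> S \<and> \<mu> x = c. u x *\<^sub>C x)"
    unfolding v using S by (intro sum.mono_neutral_right) auto
  also have "\<dots> \<in> cvec.span {x \<in> S. \<mu> x = c}"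
    by (intro cvec.span_sum cvec.span_scale cvec.span_base) simp
  finally show "v \<in> cvec.span {x \<in> S. \<mu> x = c}" .
next
  have "cvec.subspace {v. L v = c *\<^sub>C v}"
    by (rule cvec.subspaceI)
       (simp_all add: clinear_zero[OF L] clinear_add[OF L] clinear_scaleC[OF L]
         scaleC_add_right scaleC_scaleC mult.commute)
  then have "cvec.span {x \<in> S. \<mu> x = c} \<subseteq> {v. L v = c *\<^sub>C v}"
    using eig by (intro cvec.span_minimal) auto
  moreover have "cvec.span {x \<in> S. \<mu> x = c} \<subseteq> cvec.span S"
    by (rule cvec.span_mono) auto
  moreover fix v assume "v \<in> cvec.span {x \<in> S. \<mu> x = c}"
  ultimately show "v \<in> {v \<in> cvec.span S. L v = c *\<^sub>C v}" by auto
qed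


section \<open>Monomial bases of symmetric powers\<close>

lemma sym_rel_cong: "p - q \<in> sym_gens \<Longrightarrow> abs_sym_alg p = abs_sym_alg q"
  by (simp add: sym_alg.abs_eq_iff sym_rel_def cvec.span_base)

lemma sym_prod_perm: "mset xs = mset ys \<Longrightarrow> sym_prod xs = sym_prod ys"
  unfolding sym_prod.abs_eq by (intro sym_rel_cong sym_gens_perm)

lemma sym_prod_update_add:
  assumes "k < length xs"
  shows "sym_prod (xs[k := a + b]) = sym_prod (xs[k := a]) + sym_prod (xs[k := b])"
  unfolding sym_prod.abs_eq plus_sym_alg.abs_eq
  using sym_gens_add[OF assms] by (intro sym_rel_cong) (simp add: algebra_simps)

lemma sym_prod_update_scaleC:
  assumes "k < length xs"
  shows "sym_prod (xs[k := c *\<^sub>C a]) = c *\<^sub>C sym_prod (xs[k := a])"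
  unfolding sym_prod.abs_eq scaleC_sym_alg.abs_eq
  using sym_gens_scale[OF assms] by (intro sym_rel_cong)

lemma clinear_sym_prod_entry: "clinear (\<lambda>x. sym_prod (ys @ x # zs))"
  using sym_prod_update_add[of "length ys" "ys @ 0 # zs"]
    sym_prod_update_scaleC[of "length ys" "ys @ 0 # zs"]
  by (intro clinearI) simp_all

text \<open>
  Lists that are permutations of each other have the same product, so the choice of an enumeration
  of \<open>M\<close> does not matter.
\<close>

definition sym_monom :: "'v::complex_vector multiset \<Rightarrow> 'v sym_alg" where
  "sym_monom M = sym_prod (SOME xs. mset xs = M)"

lemma sym_monom_mset [simp]: "sym_monom (mset xs) = sym_prod xs"
  unfolding sym_monom_def by (rule sym_prod_perm, rule someI, rule refl)

text \<open>
  By multilinearity the entries of a product can be replaced one after the other by elements of the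
  spanning set; \<open>ys\<close> below is the part of the list already treated.
\<close>

lemma sym_power_eq_span:
  assumes "cvec.span B = UNIV"
  shows "sym_power N = cvec.span (sym_monom ` multisets_of_size B N)" (is "_ = ?S")
proof
  have "sym_prod (ys @ xs) \<in> ?S" if "set ys \<subseteq> B" "length ys + length xs = N" for xs ys
    using that
  proof (induction xs arbitrary: ys)
    case Nil
    then have "mset ys \<in> multisets_of_size B N" by (simp add: multisets_of_size_def)
    then have "sym_monom (mset ys) \<in> ?S" by (intro cvec.span_base imageI)
    then show ?case by simp
  next
    case (Cons x xs)
    note lin = clinear_sym_prod_entry[of ys xs]
    have "cvec.subspace {x. sym_prod (ys @ x # xs) \<in> ?S}"
      by (rule cvec.subspaceI)
         (auto simp: clinear_zero[OF lin] clinear_add[OF lin] clinear_scaleC[OF lin]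
           intro: cvec.span_zero cvec.span_add cvec.span_scale)
    moreover have "sym_prod (ys @ b # xs) \<in> ?S" if "b \<in> B" for b
      using Cons.IH[of "ys @ [b]"] Cons.prems that by simp
    ultimately have "cvec.span B \<subseteq> {x. sym_prod (ys @ x # xs) \<in> ?S}"
      by (intro cvec.span_minimal) auto
    then show ?case using assms by auto
  qed
  from this[of "[]"] show "sym_power N \<subseteq> ?S"
    unfolding sym_power_def by (intro cvec.span_minimal) auto
next
  have "sym_monom M \<in> {sym_prod xs |xs. length xs = N}" if "size M = N" for M
    using ex_mset[of M] that by auto
  then show "?S \<subseteq> sym_power N"
    unfolding sym_power_def by (intro cvec.span_mono) (auto simp: multisets_of_size_def)
qed

text \<open>
  The derivation property: each factor of the monomial contributes its own eigenvalue.
\<close>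

lemma sym_der_sym_monom:
  assumes T: "clinear T" and eig: "\<And>b. b \<in># M \<Longrightarrow> T b = w b *\<^sub>C b"
  shows "sym_der T (sym_monom M) = (\<Sum>b\<in>#M. w b) *\<^sub>C sym_monom M"
proof -
  obtain xs where M: "M = mset xs" by (metis ex_mset)
  have "sym_der T (sym_prod xs) = (\<Sum>i<length xs. w (xs ! i) *\<^sub>C sym_prod xs)"
    unfolding sym_der_sym_prod[OF T]
    using eig by (intro sum.cong) (simp_all add: M sym_prod_update_scaleC)
  also have "\<dots> = (\<Sum>b\<in>#M. w b) *\<^sub>C sym_prod xs"
    by (simp add: cvec.scale_sum_left[symmetric] M sum_mset_sum_list sum_list_sum_nth
        lessThan_atLeast0 flip: mset_map)
  finally show ?thesis by (simp add: M)
qed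

lemma scaleC_eq_mult: "c *\<^sub>C p = Poly_Mapping.single 0 c * (p :: 'a::monoid_add \<Rightarrow>\<^sub>0 complex)"
proof -
  have "c *\<^sub>C p = Poly_Mapping.map ((*) c) p"
    by (rule poly_mapping_eqI) (simp add: Poly_Mapping.map.rep_eq scaleC_complex_def when_def)
  then show ?thesis by (simp add: mult_map_scale_conv_mult)
qed

text \<open>
  An instance of the universal property of the symmetric algebra. The target
  \<^typ>\<open>'a multiset \<Rightarrow>\<^sub>0 complex\<close> is the polynomial ring with one variable for each element of
  \<^typ>\<open>'a\<close>: multisets are the exponents of monomials, and their sum is the product of monomials.
\<close>

lemma sym_alg_extend:
  fixes g :: "'v::complex_vector \<Rightarrow> 'a multiset \<Rightarrow>\<^sub>0 complex"
  assumes g: "clinear g"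
  obtains \<Psi> where "clinear \<Psi>" "\<And>xs. \<Psi> (sym_prod xs) = prod_list (map g xs)"
proof -
  define \<Phi> where "\<Phi> = free_ext (\<lambda>xs. prod_list (map g xs))"
  have lin: "clinear \<Phi>" unfolding \<Phi>_def by (rule clinear_free_ext)
  have word: "\<Phi> (word xs) = prod_list (map g xs)" for xs unfolding \<Phi>_def by simp
  have upd: "\<Phi> (word (xs[k := a])) = g a * prod_list (map g (take k xs @ drop (Suc k) xs))"
    if "k < length xs" for xs k a
    using that by (simp add: word upd_conv_take_nth_drop mult_ac)
  have perm_eq: "\<Phi> (word xs) = \<Phi> (word ys)" if "mset xs = mset ys" for xs ys
    using arg_cong[OF that, of "\<lambda>M. \<Prod>x\<in>#M. g x"] by (simp add: word prod_mset_prod_list flip: mset_map)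
  have "\<Phi> r = 0" if "r \<in> sym_gens" for r
  proof -
    from that consider
        (add) xs k a b where "k < length xs"
          "r = word (xs[k := a + b]) - word (xs[k := a]) - word (xs[k := b])"
      | (scale) xs k c a where "k < length xs"
          "r = word (xs[k := c *\<^sub>C a]) - c *\<^sub>C word (xs[k := a])"
      | (perm) xs ys where "mset xs = mset ys" "r = word xs - word ys"
      unfolding sym_gens_def by blast
    then show ?thesis
    proof cases
      case add
      then show ?thesis
        by (simp add: clinear_diff[OF lin] upd clinear_add[OF g] distrib_right)
    next
      case scale
      then show ?thesis
        by (simp add: clinear_diff[OF lin] clinear_scaleC[OF lin] upd clinear_scaleC[OF g]
            scaleC_eq_mult mult.assoc)
    next
      case perm
      then show ?thesis
        using perm(1)[THEN perm_eq] by (simp add: clinear_diff[OF lin])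
    qed
  qed
  then have "sym_rel \<subseteq> {r. \<Phi> r = 0}"
    unfolding sym_rel_def
    by (intro cvec.span_minimal cvec.subspaceI)
       (auto simp: clinear_zero[OF lin] clinear_add[OF lin] clinear_scaleC[OF lin])
  then have cong: "\<Phi> p = \<Phi> q" if "abs_sym_alg p = abs_sym_alg q" for p q
    using that clinear_diff[OF lin, of p q] by (auto simp: sym_alg.abs_eq_iff)
  define \<Psi> where "\<Psi> s = \<Phi> (rep_sym_alg s)" for s
  have abs: "\<Psi> (abs_sym_alg p) = \<Phi> p" for p
    unfolding \<Psi>_def by (rule cong) (rule Quotient3_abs_rep[OF Quotient3_sym_alg])
  have surj: "\<exists>p. s = abs_sym_alg p" for s :: "'v sym_alg"
    using Quotient3_abs_rep[OF Quotient3_sym_alg, of s] by metis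
  have "clinear \<Psi>"
  proof (rule clinearI)
    fix s t :: "'v sym_alg" and c
    obtain p q where "s = abs_sym_alg p" "t = abs_sym_alg q" using surj by metis
    then show "\<Psi> (s + t) = \<Psi> s + \<Psi> t" "\<Psi> (c *\<^sub>C s) = c *\<^sub>C \<Psi> s"
      by (simp_all add: plus_sym_alg.abs_eq scaleC_sym_alg.abs_eq abs clinear_add[OF lin]
          clinear_scaleC[OF lin])
  qed
  then show thesis by (rule that) (simp add: sym_prod.abs_eq abs word)
qed

text \<open>
  The extension of the linear map that sends each basis vector to the variable of the same name
  turns products of basis vectors into monomials. It serves to separate these products, which are
  classes in a quotient.
\<close>

lemma sym_monom_to_monomial:
  fixes B :: "'v::complex_vector set"
  assumes B: "finite B" "cvec.independent B" "cvec.span B = UNIV"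
  obtains \<Psi> :: "'v sym_alg \<Rightarrow> 'v multiset \<Rightarrow>\<^sub>0 complex" where "clinear \<Psi>"
    "\<And>M. set_mset M \<subseteq> B \<Longrightarrow> \<Psi> (sym_monom M) = Poly_Mapping.single M 1"
proof -
  define g :: "'v \<Rightarrow> 'v multiset \<Rightarrow>\<^sub>0 complex" where
    "g v = (\<Sum>b\<in>B. Poly_Mapping.single {#b#} (cvec.representation B v b))" for v
  have "clinear g"
  proof (rule clinearI)
    fix x y c
    show "g (x + y) = g x + g y"
      by (simp add: g_def cvec.representation_add[OF B(2)] B(3) single_add sum.distrib)
    show "g (c *\<^sub>C x) = c *\<^sub>C g x"
      by (simp add: g_def cvec.representation_scale[OF B(2)] B(3) scaleC_eq_mult mult_single
          sum_distrib_left)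
  qed
  then obtain \<Psi> where \<Psi>: "clinear \<Psi>" "\<And>xs. \<Psi> (sym_prod xs) = prod_list (map g xs)"
    by (rule sym_alg_extend) blast
  have gb: "g b = Poly_Mapping.single {#b#} 1" if "b \<in> B" for b
  proof -
    have "g b = (\<Sum>a\<in>B. if a = b then Poly_Mapping.single {#b#} 1 else 0)"
      unfolding g_def cvec.representation_basis[OF B(2) that] by (intro sum.cong) auto
    then show ?thesis using B(1) that by simp
  qed
  have "prod_list (map g xs) = Poly_Mapping.single (mset xs) 1" if "set xs \<subseteq> B" for xs
    using that by (induction xs) (simp_all add: gb mult_single)
  then have "\<Psi> (sym_monom M) = Poly_Mapping.single M 1" if "set_mset M \<subseteq> B" for M
    using \<Psi>(2) that ex_mset[of M] by (auto)
  with \<Psi>(1) show thesis by (rule that)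
qed

text \<open>
  Distinct monomials in the polynomial ring are linearly independent, and independence can be
  pulled back along a linear map.
\<close>

lemma sym_monom_basis:
  fixes B :: "'v::complex_vector set"
  assumes B: "finite B" "cvec.independent B" "cvec.span B = UNIV"
  shows "inj_on sym_monom (multisets_of_size B N)"
    and "cvec.independent (sym_monom ` multisets_of_size B N)"
proof -
  obtain \<Psi> :: "'v sym_alg \<Rightarrow> 'v multiset \<Rightarrow>\<^sub>0 complex" where lin: "clinear \<Psi>"
    and \<Psi>: "\<And>M. set_mset M \<subseteq> B \<Longrightarrow> \<Psi> (sym_monom M) = Poly_Mapping.single M 1"
    using sym_monom_to_monomial[OF B] by blast
  have look: "Poly_Mapping.lookup (\<Psi> (sym_monom M)) M' = (if M = M' then 1 else 0)"
    if "M \<in> multisets_of_size B N" for M M'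
    using that by (simp add: \<Psi> multisets_of_size_def lookup_single)
  show inj: "inj_on sym_monom (multisets_of_size B N)"
    by (rule inj_onI) (metis look zero_neq_one)
  show "cvec.independent (sym_monom ` multisets_of_size B N)"
    unfolding cvec.independent_explicit_finite_subsets
  proof (intro allI impI ballI)
    fix F u v
    assume F: "F \<subseteq> sym_monom ` multisets_of_size B N" "finite F" "(\<Sum>v\<in>F. u v *\<^sub>C v) = 0" "v \<in> F"
    then obtain M where M: "v = sym_monom M" "M \<in> multisets_of_size B N" by auto
    \<comment> \<open>The coefficient of \<open>M\<close> in the image singles out \<open>v\<close> among the elements of \<open>F\<close>.\<close>
    have "Poly_Mapping.lookup (\<Psi> s) M = (if s = v then 1 else 0)" if s: "s \<in> F" for s
      using F(1) s M inj by (auto simp: look dest: inj_onD)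
    then have "(\<Sum>s\<in>F. u s * Poly_Mapping.lookup (\<Psi> s) M) = (\<Sum>s\<in>F. if s = v then u s else 0)"
      by (intro sum.cong) simp_all
    then have "u v = (\<Sum>s\<in>F. u s * Poly_Mapping.lookup (\<Psi> s) M)"
      using F(2,4) by simp
    also have "\<dots> = Poly_Mapping.lookup (\<Psi> (\<Sum>s\<in>F. u s *\<^sub>C s)) M"
      by (simp add: clinear_sum[OF lin] clinear_scaleC[OF lin] lookup_sum scaleC_complex_def)
    finally show "u v = 0" using F(3) by (simp add: clinear_zero[OF lin])
  qed
qed


section \<open>Characters of symmetric powers\<close>

text \<open>
  The products of \<open>N\<close> vectors of a weight basis form a weight basis of the \<open>N\<close>-th symmetric
  power, and the weights of the factors add up.
\<close>

lemma weight_mult_sym_power: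
  fixes \<rho> :: "complex^2^2 \<Rightarrow> 'v \<Rightarrow> 'v::complex_vector"
  assumes lin: "clinear (\<rho> sl2_H)"
    and B: "finite B" "cvec.independent B" "cvec.span B = UNIV"
    and eig: "\<And>b. b \<in> B \<Longrightarrow> \<rho> sl2_H b = of_int (w b) *\<^sub>C b"
  shows "weight_mult (sym_power N) (sym_action \<rho>) c =
    card {M \<in> multisets_of_size B N. (\<Sum>b\<in>#M. w b) = c}"
proof -
  let ?I = "multisets_of_size B N"
  let ?J = "{M \<in> ?I. (\<Sum>b\<in>#M. w b) = c}"
  note inj = sym_monom_basis(1)[OF B, of N] and indep = sym_monom_basis(2)[OF B, of N]
  \<comment> \<open>The weight of a product is read off its multiset of factors, which the product determines.\<close>
  define \<mu> :: "'v sym_alg \<Rightarrow> complex"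
    where "\<mu> s = of_int (\<Sum>b\<in>#inv_into ?I sym_monom s. w b)" for s
  have \<mu>: "\<mu> (sym_monom M) = of_int (\<Sum>b\<in>#M. w b)" if "M \<in> ?I" for M
    using that inj by (simp add: \<mu>_def)
  have wt: "(\<Sum>b\<in>#M. of_int (w b)) = (of_int (\<Sum>b\<in>#M. w b) :: complex)" for M
    by (induction M) simp_all
  have "sym_der (\<rho> sl2_H) (sym_monom M) = \<mu> (sym_monom M) *\<^sub>C sym_monom M" if "M \<in> ?I" for M
    using sym_der_sym_monom[OF lin, of M "\<lambda>b. of_int (w b)"] eig that
    by (auto simp: \<mu> wt multisets_of_size_def)
  then have "{v \<in> sym_power N. sym_der (\<rho> sl2_H) v = of_int c *\<^sub>C v} =
      cvec.span {x \<in> sym_monom ` ?I. \<mu> x = of_int c}"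
    unfolding sym_power_eq_span[OF B(3)] using B(1) indep
    by (intro eigenspace_span clinear_sym_der[OF lin]) (auto intro: finite_multisets_of_size)
  also have "{x \<in> sym_monom ` ?I. \<mu> x = of_int c} = sym_monom ` ?J"
    by (auto simp: \<mu>)
  finally have "weight_mult (sym_power N) (sym_action \<rho>) c = cvec.dim (cvec.span (sym_monom ` ?J))"
    by (simp add: weight_mult_def sym_action_def)
  also have "\<dots> = card (sym_monom ` ?J)"
    by (intro cvec.dim_span_eq_card_independent cvec.independent_mono[OF indep]) auto
  also have "\<dots> = card ?J"
    by (intro card_image inj_on_subset[OF inj]) auto
  finally show ?thesis .
qed

text \<open>
  Grouping the multisets of size \<open>N\<close> by total weight turns \<open>h\<^sub>N\<close> at \<open>q\<^bsup>w b\<^esup>\<close> into the character.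
\<close>

lemma sl2_char_sym_power:
  fixes \<rho> :: "complex^2^2 \<Rightarrow> 'v \<Rightarrow> 'v::complex_vector"
  assumes lin: "clinear (\<rho> sl2_H)"
    and B: "finite B" "cvec.independent B" "cvec.span B = UNIV"
    and eig: "\<And>b. b \<in> B \<Longrightarrow> \<rho> sl2_H b = of_int (w b) *\<^sub>C b"
  shows "sl2_char (sym_power N) (sym_action \<rho>) = complete_homogeneous (\<lambda>b. qvar powi w b) B N"
proof -
  let ?I = "multisets_of_size B N"
  let ?wt = "\<lambda>M. \<Sum>b\<in>#M. w b"
  have fin: "finite ?I" using B(1) by (rule finite_multisets_of_size)
  have mult: "weight_mult (sym_power N) (sym_action \<rho>) c = card {M \<in> ?I. ?wt M = c}" for c
    using lin B eig by (rule weight_mult_sym_power)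
  have prod: "(\<Prod>b\<in>#M. qvar powi w b) = qvar powi ?wt M" for M
    by (induction M) (simp_all add: power_int_add)
  have "{c. weight_mult (sym_power N) (sym_action \<rho>) c \<noteq> 0} = ?wt ` ?I"
    using fin by (auto simp: mult)
  then have "sl2_char (sym_power N) (sym_action \<rho>) =
      (\<Sum>c\<in>?wt ` ?I. of_nat (card {M \<in> ?I. ?wt M = c}) * qvar powi c)"
    by (simp add: sl2_char_def mult)
  also have "\<dots> = (\<Sum>c\<in>?wt ` ?I. \<Sum>M | M \<in> ?I \<and> ?wt M = c. qvar powi ?wt M)"
  proof (rule sum.cong[OF refl])
    fix c
    have "(\<Sum>M | M \<in> ?I \<and> ?wt M = c. qvar powi ?wt M) = (\<Sum>M | M \<in> ?I \<and> ?wt M = c. qvar powi c)"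
      by (rule sum.cong) simp_all
    then show "of_nat (card {M \<in> ?I. ?wt M = c}) * qvar powi c =
        (\<Sum>M | M \<in> ?I \<and> ?wt M = c. qvar powi ?wt M)"
      by simp
  qed
  also have "\<dots> = (\<Sum>M\<in>?I. qvar powi ?wt M)"
    by (rule sum.image_gen[OF fin, symmetric])
  finally show ?thesis by (simp add: complete_homogeneous_def prod)
qed


section \<open>Weight bases of irreducible representations\<close>

definition sl2_F :: "complex^2^2" where
  "sl2_F = vector [vector [0, 0], vector [1, 0]]"

lemma sl2_basis_in [simp]: "sl2_H \<in> sl2" "sl2_E \<in> sl2" "sl2_F \<in> sl2"
  by (simp_all add: sl2_def sl2_H_def sl2_E_def sl2_F_def trace_def sum_2)

lemma sl2_mat_mult [simp]: "X \<in> sl2 \<Longrightarrow> mat c ** X \<in> sl2"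
  by (simp add: sl2_def trace_def sum_2 matrix_matrix_mult_def mat_def flip: distrib_left)

lemma sl2_add [simp]: "X \<in> sl2 \<Longrightarrow> Y \<in> sl2 \<Longrightarrow> X + Y \<in> sl2"
  by (simp add: sl2_def trace_add)

lemma sl2_decompose:
  assumes "X \<in> sl2"
  shows "X = mat (X $ 1 $ 1) ** sl2_H + mat (X $ 1 $ 2) ** sl2_E + mat (X $ 2 $ 1) ** sl2_F"
  using assms
  by (simp add: sl2_def trace_def vec_eq_iff forall_2 sum_2 matrix_matrix_mult_def mat_def
      sl2_H_def sl2_E_def sl2_F_def eq_neg_iff_add_eq_0 add.commute)

lemma lie_brackets:
  "lie_bracket sl2_E sl2_F = sl2_H" "lie_bracket sl2_H sl2_F = mat (-2) ** sl2_F"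
  by (simp_all add: lie_bracket_def vec_eq_iff forall_2 sum_2 matrix_matrix_mult_def mat_def
      sl2_H_def sl2_E_def sl2_F_def)

text \<open>
  The basis consists of the vectors \<open>F\<^sup>k v\<close> for a highest weight vector \<open>v\<close>. The commutation
  relations give their weights \<open>m - 2k\<close> and \<open>E F\<^bsup>k+1\<^esup> v = (k + 1)(m - k) F\<^sup>k v\<close>. The
  coefficient is nonzero for \<open>k < m\<close>, so no \<open>F\<^sup>k v\<close> with \<open>k \<le> m\<close> vanishes. It is zero for
  \<open>k = m\<close>, so the \<open>F\<^sup>k v\<close> with \<open>k > m\<close> span an invariant subspace. This subspace is
  proper because it does not contain \<open>v\<close>, whose weight differs from those of the spanning vectors.
  By irreducibility it is zero, and all the \<open>F\<^sup>k v\<close> together span the whole space, so those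
  with \<open>k \<le> m\<close> do.
\<close>

lemma irreducible_weight_basis:
  fixes \<rho> :: "complex^2^2 \<Rightarrow> 'v \<Rightarrow> 'v::complex_vector"
  assumes irred: "sl2_irreducible \<rho>" and hw: "highest_weight \<rho> m"
  obtains f :: "nat \<Rightarrow> 'v" where "inj_on f {0..m}" "cvec.independent (f ` {0..m})"
    "cvec.span (f ` {0..m}) = UNIV"
    "\<And>i. i \<le> m \<Longrightarrow> \<rho> sl2_H (f i) = of_int (int m - 2 * int i) *\<^sub>C f i"
proof -
  have rep: "sl2_rep \<rho>" and
    minimal: "\<And>W. cvec.subspace W \<Longrightarrow> (\<And>X. X \<in> sl2 \<Longrightarrow> \<rho> X ` W \<subseteq> W) \<Longrightarrow> W = {0} \<or> W = UNIV"
    using irred unfolding sl2_irreducible_def by blast+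
  have lin: "clinear (\<rho> X)" if "X \<in> sl2" for X
    using rep that by (simp add: sl2_rep_def)
  have scale: "\<rho> (mat c ** X) v = c *\<^sub>C \<rho> X v" if "X \<in> sl2" for c X v
    using rep that by (simp add: sl2_rep_def)
  have comm: "\<rho> X (\<rho> Y v) = \<rho> (lie_bracket X Y) v + \<rho> Y (\<rho> X v)" if "X \<in> sl2" "Y \<in> sl2" for X Y v
    using rep that by (simp add: sl2_rep_def)
  have decomp: "\<rho> X v = (X $ 1 $ 1) *\<^sub>C \<rho> sl2_H v + (X $ 1 $ 2) *\<^sub>C \<rho> sl2_E v
      + (X $ 2 $ 1) *\<^sub>C \<rho> sl2_F v" if "X \<in> sl2" for X v
  proof -
    have "\<rho> (Y + Z) v = \<rho> Y v + \<rho> Z v" if "Y \<in> sl2" "Z \<in> sl2" for Y Z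
      using rep that by (simp add: sl2_rep_def)
    then show ?thesis by (subst sl2_decompose[OF that]) (simp add: scale)
  qed
  obtain v where v: "v \<noteq> 0" "\<rho> sl2_E v = 0" "\<rho> sl2_H v = of_nat m *\<^sub>C v"
    using hw by (auto simp: highest_weight_def)
  define f where "f k = (\<rho> sl2_F ^^ k) v" for k
  have f_0: "f 0 = v" and F_f: "\<rho> sl2_F (f k) = f (Suc k)" for k
    by (simp_all add: f_def)
  define \<mu> :: "nat \<Rightarrow> complex" where "\<mu> k = of_int (int m - 2 * int k)" for k
  have H_f: "\<rho> sl2_H (f k) = \<mu> k *\<^sub>C f k" for k
  proof (induction k)
    case (Suc k)
    have "\<rho> sl2_H (f (Suc k)) = (-2) *\<^sub>C f (Suc k) + \<mu> k *\<^sub>C f (Suc k)"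
      unfolding F_f[symmetric, of k] comm[of sl2_H sl2_F, simplified] lie_brackets
      by (simp add: scale Suc clinear_scaleC[OF lin])
    also have "\<dots> = (-2 + \<mu> k) *\<^sub>C f (Suc k)"
      by (rule scaleC_add_left[symmetric])
    also have "-2 + \<mu> k = \<mu> (Suc k)" by (simp add: \<mu>_def)
    finally show ?case .
  qed (simp add: f_0 v \<mu>_def)
  have E_f: "\<rho> sl2_E (f (Suc k)) = of_int ((int k + 1) * (int m - int k)) *\<^sub>C f k" for k
  proof (induction k)
    case 0
    then show ?case
      unfolding F_f[symmetric, of 0] comm[of sl2_E sl2_F, simplified] lie_brackets
      by (simp add: f_0 v clinear_zero[OF lin])
  next
    case (Suc k)
    have "\<rho> sl2_E (f (Suc (Suc k))) =
        \<mu> (Suc k) *\<^sub>C f (Suc k) + of_int ((int k + 1) * (int m - int k)) *\<^sub>C f (Suc k)"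
      unfolding F_f[symmetric, of "Suc k"] comm[of sl2_E sl2_F, simplified] lie_brackets Suc
      by (simp add: H_f clinear_scaleC[OF lin] F_f)
    also have "\<dots> = (\<mu> (Suc k) + of_int ((int k + 1) * (int m - int k))) *\<^sub>C f (Suc k)"
      by (rule scaleC_add_left[symmetric])
    also have "\<mu> (Suc k) + of_int ((int k + 1) * (int m - int k)) =
        of_int ((int (Suc k) + 1) * (int m - int (Suc k)))"
      by (simp add: \<mu>_def algebra_simps)
    finally show ?case .
  qed
  \<comment> \<open>Such a \<open>K\<close> spans a subrepresentation: lowering needs \<open>up\<close>, raising needs \<open>down\<close>, and
    raising from \<open>m + 1\<close> to \<open>m\<close> gives zero.\<close>
  have invariant: "cvec.span (f ` K) = {0} \<or> cvec.span (f ` K) = UNIV"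
    if up: "\<And>k. k \<in> K \<Longrightarrow> Suc k \<in> K" and down: "\<And>k. Suc k \<in> K \<Longrightarrow> k \<in> K \<or> k = m" for K
  proof (rule minimal)
    fix X assume X: "X \<in> sl2"
    have "\<rho> X (f k) \<in> cvec.span (f ` K)" if k: "k \<in> K" for k
    proof -
      have "\<rho> sl2_E (f k) \<in> cvec.span (f ` K)"
      proof (cases k)
        case 0
        then show ?thesis by (simp add: f_0 v cvec.span_zero)
      next
        case (Suc j)
        then consider "j \<in> K" | "j = m" using down k by blast
        then show ?thesis
        proof cases
          case 1
          then show ?thesis unfolding Suc E_f by (intro cvec.span_scale cvec.span_base imageI)
        next
          case 2
          then show ?thesis unfolding Suc E_f by (simp add: cvec.span_zero)
        qed
      qed
      then show ?thesis
        unfolding decomp[OF X] H_f F_f using k up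
        by (intro cvec.span_add cvec.span_scale) (auto intro: cvec.span_base)
    qed
    moreover have "cvec.subspace {v. \<rho> X v \<in> cvec.span (f ` K)}"
      by (rule cvec.subspaceI)
         (auto simp: clinear_zero[OF lin[OF X]] clinear_add[OF lin[OF X]] clinear_scaleC[OF lin[OF X]]
           intro: cvec.span_zero cvec.span_add cvec.span_scale)
    ultimately show "\<rho> X ` cvec.span (f ` K) \<subseteq> cvec.span (f ` K)"
      using cvec.span_minimal[of "f ` K" "{v. \<rho> X v \<in> cvec.span (f ` K)}"] by blast
  qed (rule cvec.subspace_span)
  have inj_\<mu>: "inj_on \<mu> I" for I
    by (auto simp: inj_on_def \<mu>_def)
  \<comment> \<open>For \<open>k > m\<close> the span of these vectors is a subrepresentation that misses \<open>f 0\<close>.\<close>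
  have vanish: "f k = 0" if "k > m" for k
  proof -
    define I where "I = {k \<in> {m<..}. f k \<noteq> 0}"
    have "cvec.span (f ` {m<..}) \<noteq> UNIV"
    proof
      assume "cvec.span (f ` {m<..}) = UNIV"
      then have "f 0 \<in> cvec.span (f ` {m<..} - {0})" by simp
      also have "f ` {m<..} - {0} = f ` I" by (auto simp: I_def)
      finally have "f 0 \<in> cvec.span (f ` I)" .
      moreover have "inj_on f (insert 0 I)" and "cvec.independent (f ` insert 0 I)"
        by (rule eigenvectors_independent[OF lin inj_\<mu>, of sl2_H];
            use H_f v(1) in \<open>auto simp: I_def f_0\<close>)+
      ultimately show False
        by (auto simp: cvec.independent_insert I_def split: if_splits)
    qed
    then have "cvec.span (f ` {m<..}) = {0}" using invariant[of "{m<..}"] by fastforce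
    then show ?thesis using cvec.span_base[of "f k" "f ` {m<..}"] that by auto
  qed
  have nz: "f k \<noteq> 0" if "k \<le> m" for k
    using that
  proof (induction k)
    case (Suc k)
    \<comment> \<open>Raising leads back to a nonzero multiple of \<open>f k\<close>.\<close>
    have "\<rho> sl2_E (f (Suc k)) \<noteq> 0"
      using Suc unfolding E_f of_int_mult by (simp del: of_int_diff of_int_add)
    then show ?case using clinear_zero[OF lin, of sl2_E] by auto
  qed (simp add: f_0 v)
  have "cvec.span (range f) = UNIV"
    using invariant[of UNIV] cvec.span_base[OF rangeI, of f 0] v(1) unfolding f_0 by blast
  moreover have "range f \<subseteq> insert 0 (f ` {0..m})"
  proof (intro image_subsetI)
    fix k show "f k \<in> insert 0 (f ` {0..m})"
      using vanish[of k] by (cases "k \<le> m") simp_all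
  qed
  ultimately have "cvec.span (f ` {0..m}) = UNIV"
    by (metis cvec.span_insert_0 cvec.span_mono top.extremum_unique)
  moreover have "inj_on f {0..m}" "cvec.independent (f ` {0..m})"
    by (rule eigenvectors_independent[OF lin inj_\<mu>, of sl2_H]; use H_f nz in auto)+
  ultimately show thesis using H_f by (intro that) (simp_all add: \<mu>_def)
qed


section \<open>The character formula\<close>

theorem corollary3p7:
  fixes \<rho> :: "complex^2^2 \<Rightarrow> 'v \<Rightarrow> 'v::complex_vector"
    and m N :: nat
  assumes "sl2_irreducible \<rho>"
    and "highest_weight \<rho> m"
  shows "sl2_char (sym_power N) (sym_action \<rho>)
       = (\<Sum>i=0..m. qvar powi (int N * (int m - 2 * int i)) * A_coeff m i)"
proof -
  obtain f :: "nat \<Rightarrow> 'v" where f: "inj_on f {0..m}" "cvec.independent (f ` {0..m})"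
      "cvec.span (f ` {0..m}) = UNIV"
      "\<And>i. i \<le> m \<Longrightarrow> \<rho> sl2_H (f i) = of_int (int m - 2 * int i) *\<^sub>C f i"
    using irreducible_weight_basis[OF assms] by blast
  define w where "w b = int m - 2 * int (inv_into {0..m} f b)" for b
  define x where "x i = qvar powi (int m - 2 * int i)" for i :: nat
  have w: "w (f i) = int m - 2 * int i" if "i \<in> {0..m}" for i
    using inv_into_f_f[OF f(1) that] by (simp add: w_def)
  have x_eq_iff: "x i = x j \<longleftrightarrow> i = j" for i j
  proof
    assume "x i = x j"
    then have "qvar powi ((int m - 2 * int i) - (int m - 2 * int j)) = 1"
      by (subst power_int_diff) (simp_all add: x_def)
    then show "i = j" by (simp add: qvar_powi_eq_1_iff)
  qed simp
  have "clinear (\<rho> sl2_H)"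
    using assms(1) by (simp add: sl2_irreducible_def sl2_rep_def)
  then have "sl2_char (sym_power N) (sym_action \<rho>)
      = complete_homogeneous (\<lambda>b. qvar powi w b) (f ` {0..m}) N"
    using f by (intro sl2_char_sym_power) (auto simp: w)
  also have "\<dots> = (\<Sum>b\<in>f ` {0..m}. (qvar powi w b) ^ N *
      (\<Prod>c\<in>f ` {0..m} - {b}. qvar powi w b / (qvar powi w b - qvar powi w c)))"
    using x_eq_iff by (intro complete_homogeneous_eq_lagrange_sum) (auto simp: inj_on_def w x_def)
  also have "\<dots> = (\<Sum>i=0..m. x i ^ N * (\<Prod>j\<in>{0..m} - {i}. x i / (x i - x j)))"
    unfolding sum.reindex[OF f(1)] o_def
  proof (rule sum.cong[OF refl])
    fix i assume i: "i \<in> {0..m}"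
    have "f ` {0..m} - {f i} = f ` ({0..m} - {i})"
      using i f(1) by (auto simp: inj_on_def)
    moreover have "inj_on f ({0..m} - {i})"
      using f(1) by (rule inj_on_subset) auto
    ultimately show "(qvar powi w (f i)) ^ N *
        (\<Prod>c\<in>f ` {0..m} - {f i}. qvar powi w (f i) / (qvar powi w (f i) - qvar powi w c))
      = x i ^ N * (\<Prod>j\<in>{0..m} - {i}. x i / (x i - x j))"
      using i by (simp add: prod.reindex w x_def)
  qed
  also have "\<dots> = (\<Sum>i=0..m. qvar powi (int N * (int m - 2 * int i)) * A_coeff m i)"
    by (intro sum.cong)
       (simp_all add: A_coeff_eq_lagrange_factor x_def power_int_mult mult.commute[of "int N"])
  finally show ?thesis .
qed

end
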